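(* Let $n,k\ge 1$ be integers such that $k$ divides $n$, and let $M\in\mathbb{C}^{n\times n}$ be a matrix of rank at most $k$. Then for every $\epsilon>0$ there exists a sequence of $4k+1$ matrices $A^{(1)},\dots,A^{(4k+1)}\in\mathbb{C}^{n\times n}$, where $A^{(i)}$ is a circulant matrix if $i$ is odd and a diagonal matrix if $i$ is even, such that $$\left\|A^{(1)}A^{(2)}\cdots A^{(4k+1)}-M\right\|_{F}<\epsilon .$$
   Context: A matrix $C\in\mathbb{C}^{n\times n}$ is circulant if there is $(c_0,\dots,c_{n-1})\in\mathbb{C}^n$ with $C_{j,l}=c_{(j-l)\bmod n}$ for all $0\le j,l\le n-1$. $\|\cdot\|_F$ is the Frobenius norm. *)

theory Defs
  imports Complex_Main "Jordan_Normal_Form.Matrix" "Jordan_Normal_Form.DL_Rank"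
begin

text \<open>
  The difference \<open>j - l\<close> is taken in the integers; \<open>mod\<close> on \<open>int\<close> returns the residue
  in \<open>{0..<n}\<close>.
\<close>
definition circulant_mat :: "nat \<Rightarrow> 'a mat \<Rightarrow> bool" where
  "circulant_mat n C \<longleftrightarrow> C \<in> carrier_mat n n \<and>
     (\<exists>c \<in> carrier_vec n. \<forall>j<n. \<forall>l<n. C $$ (j, l) = c $ nat ((int j - int l) mod int n))"

definition frobenius_norm :: "complex mat \<Rightarrow> real" where
  "frobenius_norm A = sqrt (\<Sum>i<dim_row A. \<Sum>j<dim_col A. (cmod (A $$ (i, j)))\<^sup>2)"

text \<open>
  Ordered product of a list of \<open>n \<times> n\<close> matrices. The type of matrices of all dimensions has no
  unit element, so \<open>prod_list\<close> is not available.
\<close>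
definition mat_prod_list :: "nat \<Rightarrow> 'a::semiring_1 mat list \<Rightarrow> 'a mat" where
  "mat_prod_list n As = foldr (*) As (1\<^sub>m n)"

end

theory Submission
  imports Defs "Jordan_Normal_Form.Spectral_Radius"
begin

text \<open>
  Conjugation by the discrete Fourier transform turns diagonal matrices into circulant ones and
  the matrices \<open>c I + J\<close>, where \<open>J\<close> is the all-ones matrix, into diagonal ones. So it is enough to
  approximate a matrix of rank at most \<open>k\<close> by alternating products of \<open>2 k + 1\<close> diagonal matrices
  and \<open>2 k\<close> matrices \<open>c I + J\<close>. The identity with one column replaced by an arbitrary vector is a
  limit of products \<open>D (c I + J) D'\<close> with \<open>c\<close> tending to infinity; \<open>k\<close> such factors approximate any
  matrix that differs from the identity in \<open>k\<close> columns only. A matrix of rank at most \<open>k\<close> is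
  \<open>P Z Q\<close>, where \<open>Z\<close> is a diagonal projection of rank \<open>k\<close> and \<open>P\<close> and the transpose of \<open>Q\<close>
  are matrices of this kind.
\<close>

subsection \<open>Entrywise closure of a set of matrices\<close>

text \<open>The topological closure of the \<open>n \<times> n\<close> members of \<open>S\<close>.
  In finite dimension entrywise closeness gives the same topology as the Frobenius norm and is
  easier to carry through products.\<close>

definition mat_cl :: "nat \<Rightarrow> complex mat set \<Rightarrow> complex mat set" where
  "mat_cl n S = {X \<in> carrier_mat n n. \<forall>e>0. \<exists>Y \<in> S \<inter> carrier_mat n n.
     \<forall>i<n. \<forall>j<n. cmod (Y $$ (i, j) - X $$ (i, j)) < e}"

lemma mat_cl_carrier: "X \<in> mat_cl n S \<Longrightarrow> X \<in> carrier_mat n n"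
  by (simp add: mat_cl_def)

lemma mat_cl_superset: "X \<in> S \<Longrightarrow> X \<in> carrier_mat n n \<Longrightarrow> X \<in> mat_cl n S"
  unfolding mat_cl_def by (auto intro!: bexI[of _ X])

text \<open>Permits limits of limits: a perturbed matrix only has to lie in the closure, not in the
  set itself.\<close>

lemma mat_cl_idem:
  assumes "X \<in> mat_cl n (mat_cl n S)"
  shows "X \<in> mat_cl n S"
  unfolding mat_cl_def
proof (intro CollectI conjI allI impI)
  show "X \<in> carrier_mat n n" using assms by (rule mat_cl_carrier)
  fix e :: real
  assume "e > 0"
  then have e2: "e / 2 > 0" by simp
  obtain Y where Y: "Y \<in> mat_cl n S"
    "\<And>i j. i < n \<Longrightarrow> j < n \<Longrightarrow> cmod (Y $$ (i, j) - X $$ (i, j)) < e / 2"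
    using assms e2 unfolding mat_cl_def[of n "mat_cl n S"] by blast
  obtain Z where Z: "Z \<in> S \<inter> carrier_mat n n"
    "\<And>i j. i < n \<Longrightarrow> j < n \<Longrightarrow> cmod (Z $$ (i, j) - Y $$ (i, j)) < e / 2"
    using Y(1) e2 unfolding mat_cl_def by blast
  have "cmod (Z $$ (i, j) - X $$ (i, j)) < e" if "i < n" "j < n" for i j
    using norm_triangle_lt[of "Z $$ (i, j) - Y $$ (i, j)" "Y $$ (i, j) - X $$ (i, j)" e]
      Y(2)[OF that] Z(2)[OF that] by simp
  with Z(1) show "\<exists>Z \<in> S \<inter> carrier_mat n n.
      \<forall>i<n. \<forall>j<n. cmod (Z $$ (i, j) - X $$ (i, j)) < e" by blast
qed

text \<open>A general filter covers both sequences and perturbations at \<open>at 0\<close>; there,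
  finitely many bad parameters are harmless because membership is only required eventually.\<close>

lemma mat_cl_limitI:
  assumes "F \<noteq> bot" and "X \<in> carrier_mat n n"
    and ev: "\<forall>\<^sub>F x in F. Y x \<in> S \<inter> carrier_mat n n"
    and lim: "\<And>i j. i < n \<Longrightarrow> j < n \<Longrightarrow> ((\<lambda>x. Y x $$ (i, j)) \<longlongrightarrow> X $$ (i, j)) F"
  shows "X \<in> mat_cl n S"
  unfolding mat_cl_def
proof (intro CollectI conjI allI impI assms(2))
  fix e :: real
  assume "e > 0"
  have "\<forall>\<^sub>F x in F. \<forall>i\<in>{..<n}. \<forall>j\<in>{..<n}. dist (Y x $$ (i, j)) (X $$ (i, j)) < e"
    by (intro eventually_ball_finite finite_lessThan ballI tendstoD lim \<open>e > 0\<close>) auto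
  with ev have "\<forall>\<^sub>F x in F. Y x \<in> S \<inter> carrier_mat n n \<and>
      (\<forall>i\<in>{..<n}. \<forall>j\<in>{..<n}. dist (Y x $$ (i, j)) (X $$ (i, j)) < e)"
    by (rule eventually_conj)
  from eventually_happens'[OF assms(1) this]
  show "\<exists>Z \<in> S \<inter> carrier_mat n n. \<forall>i<n. \<forall>j<n. cmod (Z $$ (i, j) - X $$ (i, j)) < e"
    by (auto simp: dist_norm)
qed

lemma mat_cl_sequence:
  assumes "X \<in> mat_cl n S"
  obtains Y where "\<And>m. Y m \<in> S \<inter> carrier_mat n n"
    and "\<And>i j. i < n \<Longrightarrow> j < n \<Longrightarrow> (\<lambda>m. Y m $$ (i, j)) \<longlonglongrightarrow> X $$ (i, j)"
proof -
  have "\<exists>Z \<in> S \<inter> carrier_mat n n. \<forall>i<n. \<forall>j<n.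
      cmod (Z $$ (i, j) - X $$ (i, j)) < 1 / real (Suc m)" for m
    using assms unfolding mat_cl_def by auto
  then obtain Y where Y: "\<And>m. Y m \<in> S \<inter> carrier_mat n n"
    "\<And>m i j. i < n \<Longrightarrow> j < n \<Longrightarrow> cmod (Y m $$ (i, j) - X $$ (i, j)) < 1 / real (Suc m)"
    by metis
  have "(\<lambda>m. Y m $$ (i, j)) \<longlonglongrightarrow> X $$ (i, j)" if "i < n" "j < n" for i j
    by (rule LIM_zero_cancel, rule LIMSEQ_norm_0) (use Y(2)[OF that] in simp)
  with Y(1) show ?thesis by (rule that)
qed

lemma index_mult_mat_sum:
  assumes "A \<in> carrier_mat n n" and "B \<in> carrier_mat n n" and "i < n" and "j < n"
  shows "(A * B) $$ (i, j) = (\<Sum>l<n. A $$ (i, l) * B $$ (l, j))"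
  using assms by (auto simp: scalar_prod_def lessThan_atLeast0 intro!: sum.cong)

text \<open>Matrix multiplication is continuous, each entry of a product being a polynomial in the
  entries of the factors. The separate target set \<open>R\<close> lets word lengths add up.\<close>

lemma mat_cl_mult:
  assumes X: "X \<in> mat_cl n S" and Y: "Y \<in> mat_cl n T"
    and mult: "\<And>A B. A \<in> S \<Longrightarrow> B \<in> T \<Longrightarrow> A * B \<in> R"
  shows "X * Y \<in> mat_cl n R"
proof -
  note carr = X[THEN mat_cl_carrier] Y[THEN mat_cl_carrier]
  obtain A where A: "\<And>m. A m \<in> S \<inter> carrier_mat n n"
    "\<And>i j. i < n \<Longrightarrow> j < n \<Longrightarrow> (\<lambda>m. A m $$ (i, j)) \<longlonglongrightarrow> X $$ (i, j)"
    using mat_cl_sequence[OF X] by blast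
  obtain B where B: "\<And>m. B m \<in> T \<inter> carrier_mat n n"
    "\<And>i j. i < n \<Longrightarrow> j < n \<Longrightarrow> (\<lambda>m. B m $$ (i, j)) \<longlonglongrightarrow> Y $$ (i, j)"
    using mat_cl_sequence[OF Y] by blast
  show ?thesis
  proof (rule mat_cl_limitI[where F = sequentially and Y = "\<lambda>m. A m * B m"])
    show "\<forall>\<^sub>F m in sequentially. A m * B m \<in> R \<inter> carrier_mat n n"
      using A(1) B(1) mult by (intro always_eventually) (auto intro: mult_carrier_mat)
    fix i j assume ij: "i < n" "j < n"
    have "(\<lambda>m. \<Sum>l<n. A m $$ (i, l) * B m $$ (l, j)) \<longlonglongrightarrow> (\<Sum>l<n. X $$ (i, l) * Y $$ (l, j))"
      using ij by (intro tendsto_sum tendsto_mult A(2) B(2)) auto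
    then show "(\<lambda>m. (A m * B m) $$ (i, j)) \<longlonglongrightarrow> (X * Y) $$ (i, j)"
      using A(1) B(1) by (simp only: index_mult_mat_sum[OF carr ij] Int_iff index_mult_mat_sum[OF _ _ ij])
  qed (use carr in auto)
qed

lemma mat_cl_transpose:
  assumes "X \<in> mat_cl n S" and "\<And>A. A \<in> S \<Longrightarrow> transpose_mat A \<in> S"
  shows "transpose_mat X \<in> mat_cl n S"
proof -
  obtain A where A: "\<And>m. A m \<in> S \<inter> carrier_mat n n"
    "\<And>i j. i < n \<Longrightarrow> j < n \<Longrightarrow> (\<lambda>m. A m $$ (i, j)) \<longlonglongrightarrow> X $$ (i, j)"
    using mat_cl_sequence[OF assms(1)] by blast
  note X = mat_cl_carrier[OF assms(1)]
  show ?thesis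
  proof (rule mat_cl_limitI[where F = sequentially and Y = "\<lambda>m. transpose_mat (A m)"])
    fix i j assume "i < n" "j < n"
    moreover from this A(1)[THEN IntD2] have "transpose_mat (A m) $$ (i, j) = A m $$ (j, i)" for m
      using index_transpose_mat(1)[of i "A m" j] by (metis carrier_matD)
    ultimately show "(\<lambda>m. transpose_mat (A m) $$ (i, j)) \<longlonglongrightarrow> transpose_mat X $$ (i, j)"
      using X A(2)[of j i] by simp
  qed (use A(1) assms(2) X in \<open>auto intro!: always_eventually\<close>)
qed

subsection \<open>Words in diagonal matrices and shifted all-ones matrices\<close>

definition scalar_plus_ones :: "nat \<Rightarrow> complex \<Rightarrow> complex mat" where
  "scalar_plus_ones n c = mat n n (\<lambda>(i, j). (if i = j then c else 0) + 1)"

text \<open>The second argument counts the shifted all-ones factors. Words begin and end with a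
  diagonal factor, so in a product of two words the adjacent diagonal factors merge and the counts
  add.\<close>

fun diag_ones_word :: "nat \<Rightarrow> nat \<Rightarrow> complex mat set" where
  "diag_ones_word n 0 = range (mat_diag n)"
| "diag_ones_word n (Suc r) =
    {mat_diag n d * scalar_plus_ones n c * X | d c X. X \<in> diag_ones_word n r}"

lemma scalar_plus_ones_carrier [simp]: "scalar_plus_ones n c \<in> carrier_mat n n"
  by (simp add: scalar_plus_ones_def)

lemma diag_ones_word_carrier: "X \<in> diag_ones_word n r \<Longrightarrow> X \<in> carrier_mat n n"
  by (induction r arbitrary: X) (auto intro!: mult_carrier_mat[of _ n n _ n])

lemma diag_mult_word:
  assumes "X \<in> diag_ones_word n r"
  shows "mat_diag n d * X \<in> diag_ones_word n r"
proof (cases r)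
  case 0
  with assms show ?thesis by auto
next
  case (Suc s)
  with assms obtain e c Y where Y: "Y \<in> diag_ones_word n s"
    and X: "X = mat_diag n e * scalar_plus_ones n c * Y" by auto
  have "mat_diag n d * X = (mat_diag n d * mat_diag n e) * scalar_plus_ones n c * Y"
    unfolding X using diag_ones_word_carrier[OF Y]
    by (simp add: assoc_mult_mat[of _ n n _ n _ n] mult_carrier_mat[of _ n n _ n] del: mat_diag_diag)
  with Y Suc show ?thesis by auto
qed

lemma word_mult_word:
  assumes "X \<in> diag_ones_word n r" and Y: "Y \<in> diag_ones_word n s"
  shows "X * Y \<in> diag_ones_word n (r + s)"
  using assms(1)
proof (induction r arbitrary: X)
  case 0
  with Y show ?case by (auto intro: diag_mult_word)
next
  case (Suc r)
  then obtain e c Z where Z: "Z \<in> diag_ones_word n r"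
    and X: "X = mat_diag n e * scalar_plus_ones n c * Z" by auto
  have "X * Y = mat_diag n e * scalar_plus_ones n c * (Z * Y)"
    unfolding X using diag_ones_word_carrier[OF Y] diag_ones_word_carrier[OF Z]
    by (simp add: assoc_mult_mat[of _ n n _ n _ n] mult_carrier_mat[of _ n n _ n])
  with Suc.IH[OF Z] show ?case by auto
qed

lemma word_oneI: "mat_diag n d * scalar_plus_ones n c * mat_diag n e \<in> diag_ones_word n 1"
  by (simp only: One_nat_def diag_ones_word.simps) blast

text \<open>Both kinds of factors are symmetric, so transposition only reverses a word. This
  transfers results about columns to rows.\<close>

lemma transpose_word:
  assumes "X \<in> diag_ones_word n r"
  shows "transpose_mat X \<in> diag_ones_word n r"
  using assms
proof (induction r arbitrary: X)
  have diag: "transpose_mat (mat_diag n d) = mat_diag n d" for d :: "nat \<Rightarrow> complex"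
    by (auto simp: mat_diag_def)
  {
    case 0
    then show ?case by (auto simp: diag)
  next
    case (Suc r)
    then obtain e c Z where Z: "Z \<in> diag_ones_word n r"
      and X: "X = mat_diag n e * scalar_plus_ones n c * Z" by auto
    have "transpose_mat X = transpose_mat Z * (scalar_plus_ones n c * mat_diag n e)"
      unfolding X using diag_ones_word_carrier[OF Z]
      by (simp add: transpose_mult[of _ n n _ n] mult_carrier_mat[of _ n n _ n] diag)
        (auto simp: scalar_plus_ones_def intro!: arg_cong2[where f = "(*)"])
    \<comment> \<open>An identity factor in front completes this piece to a word with one shifted
      all-ones factor.\<close>
    moreover have "scalar_plus_ones n c * mat_diag n e =
        mat_diag n (\<lambda>_. 1) * scalar_plus_ones n c * mat_diag n e"
      by (simp add: left_mult_one_mat[of _ n n])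
    ultimately show ?case
      using word_mult_word[OF Suc.IH[OF Z] word_oneI[of n "\<lambda>_. 1" c e]] by simp
  }
qed

section \<open>Limits of words: matrices that differ from the identity in few columns\<close>

definition identity_replace_col :: "nat \<Rightarrow> nat \<Rightarrow> (nat \<Rightarrow> complex) \<Rightarrow> complex mat" where
  "identity_replace_col n s a = mat n n (\<lambda>(i, j). if j = s then a i else if i = j then 1 else 0)"

lemma identity_replace_col_nonzero_in_closure:
  assumes nz: "\<And>i. i < n \<Longrightarrow> a i \<noteq> 0"
  shows "identity_replace_col n s a \<in> mat_cl n (diag_ones_word n 1)"
proof (rule mat_cl_limitI[where F = "at 0"])
  \<comment> \<open>With \<open>c = 1 / \<delta>\<close> the entries are \<open>u i * v j\<close>,
    plus \<open>u i * v i / \<delta>\<close> on the diagonal. Outside row and column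
    \<open>s\<close>, \<open>u i * v j = a i * \<delta> / a j\<close> vanishes in the limit, while
    the diagonal becomes \<open>1 + \<delta>\<close>. Column \<open>s\<close> has
    \<open>v = 1\<close> and so shows \<open>a i\<close>; the extra \<open>\<delta>\<close> in
    \<open>u s\<close> cancels \<open>1 / \<delta>\<close> at the pivot and makes the rest of row
    \<open>s\<close> vanish.\<close>
  define u v where "u = (\<lambda>\<delta> i. if i = s then a s * \<delta> else a i)"
    and "v = (\<lambda>\<delta> i. if i = s then 1 else \<delta> / a i)"
  define Y where "Y = (\<lambda>\<delta>. mat_diag n (u \<delta>) * scalar_plus_ones n (1 / \<delta>) * mat_diag n (v \<delta>))"
  have carr: "Y \<delta> \<in> carrier_mat n n" for \<delta>
    unfolding Y_def by (intro mult_carrier_mat[of _ n n _ n]) auto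
  show "\<forall>\<^sub>F \<delta> in at 0. Y \<delta> \<in> diag_ones_word n 1 \<inter> carrier_mat n n"
    using carr word_oneI by (auto simp: Y_def intro!: always_eventually)
  fix i j assume ij: "i < n" "j < n"
  have "Y \<delta> $$ (i, j) = u \<delta> i * ((if i = j then 1 / \<delta> else 0) + 1) * v \<delta> j" for \<delta>
    unfolding Y_def using ij
    by (simp add: mat_diag_mult_left[of _ n n] mat_diag_mult_right[of _ n n] scalar_plus_ones_def)
  moreover have "((\<lambda>\<delta>. u \<delta> i * ((if i = j then 1 / \<delta> else 0) + 1) * v \<delta> j) \<longlongrightarrow>
      (if j = s then a i else if i = j then 1 else 0)) (at 0)"
  proof -
    have ne: "\<forall>\<^sub>F \<delta> in at (0::complex). \<delta> \<noteq> 0" by (rule eventually_neq_at_within)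
    consider "i = s" "j = s" | "i = s" "j \<noteq> s" | "i \<noteq> s" "j = s"
      | "i \<noteq> s" "j \<noteq> s" "i = j" | "i \<noteq> s" "j \<noteq> s" "i \<noteq> j" by blast
    then show ?thesis
    proof cases
      case 1
      have "((\<lambda>\<delta>. a s * (1 + \<delta>)) \<longlongrightarrow> a s) (at 0)" by (auto intro!: tendsto_eq_intros)
      moreover have "\<forall>\<^sub>F \<delta> in at 0. a s * (1 + \<delta>) = a s * \<delta> * (1 / \<delta> + 1)"
        using ne by eventually_elim (simp add: field_simps)
      ultimately have "((\<lambda>\<delta>. a s * \<delta> * (1 / \<delta> + 1)) \<longlongrightarrow> a s) (at 0)"
        by (rule Lim_transform_eventually)
      with 1 show ?thesis by (simp add: u_def v_def)
    next
      case 2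
      have "((\<lambda>\<delta>. a s * \<delta> * (\<delta> / a j)) \<longlongrightarrow> a s * 0 * (0 / a j)) (at 0)"
        using nz[OF ij(2)] by (intro tendsto_intros)
      with 2 show ?thesis by (simp add: u_def v_def)
    next
      case 3
      then show ?thesis by (simp add: u_def v_def)
    next
      case 4
      have "((\<lambda>\<delta>. 1 + \<delta>) \<longlongrightarrow> (1::complex)) (at 0)" by (auto intro!: tendsto_eq_intros)
      moreover have "\<forall>\<^sub>F \<delta> in at 0. 1 + \<delta> = a j * (1 / \<delta> + 1) * (\<delta> / a j)"
        using ne by eventually_elim (simp add: field_simps nz[OF ij(2)])
      ultimately have "((\<lambda>\<delta>. a j * (1 / \<delta> + 1) * (\<delta> / a j)) \<longlongrightarrow> 1) (at 0)"
        by (rule Lim_transform_eventually)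
      with 4 show ?thesis by (simp add: u_def v_def)
    next
      case 5
      have "((\<lambda>\<delta>. a i * (\<delta> / a j)) \<longlongrightarrow> a i * (0 / a j)) (at 0)"
        using nz[OF ij(2)] by (intro tendsto_intros)
      with 5 show ?thesis by (simp add: u_def v_def)
    qed
  qed
  ultimately show "((\<lambda>\<delta>. Y \<delta> $$ (i, j)) \<longlongrightarrow> identity_replace_col n s a $$ (i, j)) (at 0)"
    using ij by (simp add: identity_replace_col_def)
qed (auto simp: identity_replace_col_def)

text \<open>Adding a common small \<delta> to all entries of \<open>a\<close> makes them nonzero for
  all but finitely many \<delta>, which reduces to the nonvanishing case.\<close>

lemma identity_replace_col_in_closure: "identity_replace_col n s a \<in> mat_cl n (diag_ones_word n 1)"
proof (rule mat_cl_idem, rule mat_cl_limitI[where F = "at 0"])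
  have "\<forall>\<^sub>F \<delta> in at 0. \<forall>i\<in>{..<n}. \<delta> \<noteq> - a i"
    by (intro eventually_ball_finite ballI eventually_neq_at_within) auto
  then show "\<forall>\<^sub>F \<delta> in at 0. identity_replace_col n s (\<lambda>i. a i + \<delta>)
      \<in> mat_cl n (diag_ones_word n 1) \<inter> carrier_mat n n"
  proof eventually_elim
    case (elim \<delta>)
    then have "a i + \<delta> \<noteq> 0" if "i < n" for i
      using that by (metis add_eq_0_iff lessThan_iff)
    then show ?case
      using identity_replace_col_nonzero_in_closure[of n "\<lambda>i. a i + \<delta>" s] mat_cl_carrier by blast
  qed
  fix i j assume ij: "i < n" "j < n"
  have "((\<lambda>\<delta>. a i + \<delta>) \<longlongrightarrow> a i) (at 0)" by (auto intro!: tendsto_eq_intros)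
  then show "((\<lambda>\<delta>. identity_replace_col n s (\<lambda>i. a i + \<delta>) $$ (i, j)) \<longlongrightarrow> identity_replace_col n s a $$ (i, j)) (at 0)"
    using ij by (simp add: identity_replace_col_def)
qed (auto simp: identity_replace_col_def)

lemma invertible_solve:
  fixes A :: "'a::field mat"
  assumes A: "A \<in> carrier_mat n n" and "det A \<noteq> 0" and b: "b \<in> carrier_vec n"
  obtains x where "x \<in> carrier_vec n" and "A *\<^sub>v x = b"
proof
  note adj = adj_mat[OF A]
  \<comment> \<open>Cramer's rule: the adjugate divided by the determinant is the inverse.\<close>
  let ?x = "adj_mat A *\<^sub>v ((1 / det A) \<cdot>\<^sub>v b)"
  show "?x \<in> carrier_vec n" using adj(1) b by auto
  have "A *\<^sub>v ?x = (A * adj_mat A) *\<^sub>v ((1 / det A) \<cdot>\<^sub>v b)"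
    using A adj(1) b by (simp add: assoc_mult_mat_vec[of _ n n _ n])
  also have "\<dots> = b"
    unfolding adj(2) using b assms(2)
    by (intro eq_vecI) (auto simp: smult_scalar_prod_distrib[of _ n])
  finally show "A *\<^sub>v ?x = b" .
qed

text \<open>
  The last of the \<open>s + 1\<close> columns is produced by a right factor \<open>identity_replace_col n s a\<close>, where \<open>a\<close>
  solves a linear system. Mixing in a small multiple of the identity makes that system solvable.
\<close>
lemma unit_cols_in_closure:
  assumes "s \<le> n" and "T \<in> carrier_mat n n"
    and "\<And>i j. i < n \<Longrightarrow> j < n \<Longrightarrow> s \<le> j \<Longrightarrow> T $$ (i, j) = (if i = j then 1 else 0)"
  shows "T \<in> mat_cl n (diag_ones_word n s)"
  using assms
proof (induction s arbitrary: T)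
  case 0
  then have "T = mat_diag n (\<lambda>_. 1)" by (intro eq_matI) (auto simp: mat_diag_def)
  then show ?case using 0 by (intro mat_cl_superset) (auto simp del: mat_diag_one)
next
  case (Suc s)
  then have s: "s < n" by simp
  note T = Suc.prems(2)
  \<comment> \<open>\<open>B\<close> is \<open>T\<close> with column \<open>s\<close> reset to a
    unit vector. \<open>C \<eta>\<close> adds \<open>\<eta>\<close> times the identity; dividing by
    \<open>1 + \<eta>\<close> keeps the unit columns, so the induction hypothesis applies to
    \<open>C \<eta>\<close>. \<open>Y \<eta>\<close> puts column \<open>s\<close> of
    \<open>T\<close> back and tends to \<open>T\<close>.\<close>
  define B where "B = mat n n (\<lambda>(i, j). if j = s then if i = j then 1 else 0 else T $$ (i, j))"
  define C where "C = (\<lambda>\<eta>. mat n n (\<lambda>(i, j). (B $$ (i, j) + (if i = j then \<eta> else 0)) / (1 + \<eta>)))"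
  define Y where "Y = (\<lambda>\<eta>. mat n n (\<lambda>(i, j). if j = s then T $$ (i, s) else C \<eta> $$ (i, j)))"
  have B: "B \<in> carrier_mat n n" by (simp add: B_def)
  have Bcols: "B $$ (i, j) = (if i = j then 1 else 0)" if "i < n" "j < n" "s \<le> j" for i j
    using that Suc.prems(3)[of i j] by (auto simp: B_def)
  \<comment> \<open>\<open>char_matrix B (- \<eta>)\<close> is \<open>B\<close> plus
    \<open>\<eta>\<close> times the identity. It is singular only if \<open>- \<eta>\<close> is one
    of the finitely many eigenvalues of \<open>B\<close>.\<close>
  have "\<forall>\<^sub>F \<eta> in at 0. \<forall>e\<in>spectrum B. \<eta> \<noteq> - e"
    by (intro eventually_ball_finite ballI eventually_neq_at_within card_finite_spectrum(1)[OF B])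
  moreover have "\<forall>\<^sub>F \<eta> in at (0::complex). \<eta> \<noteq> -1" by (rule eventually_neq_at_within)
  ultimately have ev: "\<forall>\<^sub>F \<eta> in at 0. Y \<eta> \<in> mat_cl n (diag_ones_word n (Suc s)) \<inter> carrier_mat n n"
  proof eventually_elim
    case (elim \<eta>)
    then have \<eta>: "1 + \<eta> \<noteq> 0" by (metis add_eq_0_iff)
    from elim have "\<not> eigenvalue B (- \<eta>)" by (auto simp: spectrum_def)
    then have "det (char_matrix B (- \<eta>)) \<noteq> 0" using eigenvalue_det[OF B] by simp
    then obtain x where x: "x \<in> carrier_vec n" "char_matrix B (- \<eta>) *\<^sub>v x = col T s"
      using invertible_solve[of "char_matrix B (- \<eta>)" n "col T s"] B T s by auto
    have C: "C \<eta> \<in> mat_cl n (diag_ones_word n s)"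
      using \<eta> s by (intro Suc.IH) (auto simp: C_def Bcols)
    \<comment> \<open>The factor \<open>1 + \<eta>\<close> undoes the division in
      \<open>C \<eta>\<close>, so column \<open>s\<close> of the product is
      \<open>char_matrix B (- \<eta>)\<close> applied to \<open>x\<close>, that is, column
      \<open>s\<close> of \<open>T\<close>. All other columns of \<open>C \<eta>\<close> are
      copied.\<close>
    let ?R = "identity_replace_col n s (\<lambda>i. (1 + \<eta>) * x $ i)"
    have CR: "C \<eta> * ?R \<in> mat_cl n (diag_ones_word n (Suc s))"
      unfolding Suc_eq_plus1 by (rule mat_cl_mult[OF C identity_replace_col_in_closure word_mult_word])
    have "C \<eta> * ?R = Y \<eta>"
    proof (rule eq_matI)
      fix i j assume "i < dim_row (Y \<eta>)" "j < dim_col (Y \<eta>)"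
      then have ij: "i < n" "j < n" by (auto simp: Y_def)
      have "(C \<eta> * ?R) $$ (i, j) = (\<Sum>l<n. C \<eta> $$ (i, l) * ?R $$ (l, j))"
        using ij mat_cl_carrier[OF C]
        by (intro index_mult_mat_sum) (auto simp: identity_replace_col_def)
      also have "\<dots> = Y \<eta> $$ (i, j)"
      proof (cases "j = s")
        case True
        have "(\<Sum>l<n. C \<eta> $$ (i, l) * ?R $$ (l, j)) = (\<Sum>l<n. char_matrix B (- \<eta>) $$ (i, l) * x $ l)"
          using ij True \<eta> B by (intro sum.cong) (auto simp: C_def identity_replace_col_def char_matrix_def)
        also have "\<dots> = (char_matrix B (- \<eta>) *\<^sub>v x) $ i"
          using ij x(1) char_matrix_closed[OF B, of "- \<eta>"]
          by (auto simp: scalar_prod_def lessThan_atLeast0 intro!: sum.cong)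
        also have "\<dots> = Y \<eta> $$ (i, j)" using ij True T x(2) by (simp add: Y_def)
        finally show ?thesis .
      next
        case False
        have "(\<Sum>l<n. C \<eta> $$ (i, l) * ?R $$ (l, j)) = (\<Sum>l<n. if l = j then C \<eta> $$ (i, l) else 0)"
          using ij False by (intro sum.cong) (auto simp: identity_replace_col_def)
        then show ?thesis using ij False by (simp add: Y_def)
      qed
      finally show "(C \<eta> * ?R) $$ (i, j) = Y \<eta> $$ (i, j)" .
    qed (auto simp: C_def Y_def identity_replace_col_def)
    with CR mat_cl_carrier[OF CR] show ?case by (simp only: Int_iff simp_thms)
  qed
  show ?case
  proof (rule mat_cl_idem, rule mat_cl_limitI[OF _ T ev])
    fix i j assume ij: "i < n" "j < n"
    show "((\<lambda>\<eta>. Y \<eta> $$ (i, j)) \<longlongrightarrow> T $$ (i, j)) (at 0)"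
    proof (cases "j = s")
      case False
      have "((\<lambda>\<eta>. (T $$ (i, j) + (if i = j then \<eta> else 0)) / (1 + \<eta>)) \<longlongrightarrow>
          (T $$ (i, j) + (if i = j then 0 else 0)) / (1 + 0)) (at 0)"
        by (cases "i = j") (auto intro!: tendsto_eq_intros)
      with False ij show ?thesis by (simp add: Y_def C_def B_def)
    qed (use ij in \<open>simp add: Y_def\<close>)
  qed simp
qed

subsection \<open>Rank factorization\<close>

text \<open>A maximal independent set of columns has as many members as the rank and spans all
  columns; the coordinates of the columns in it form the right factor.\<close>

lemma rank_factorization:
  fixes M :: "'a::field mat"
  assumes M: "M \<in> carrier_mat n m" and rank: "vec_space.rank n M \<le> k"
  obtains u v where "\<And>i j. i < n \<Longrightarrow> j < m \<Longrightarrow> M $$ (i, j) = (\<Sum>l<k. u i l * v l j)"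
proof -
  interpret vec_space "TYPE('a)" n .
  let ?P = "\<lambda>T. T \<subseteq> set (cols M) \<and> lin_indpt T"
  have colsM: "set (cols M) \<subseteq> carrier_vec n" using cols_dim[of M] M by auto
  have "lin_indpt {}" by (auto simp: lin_dep_def)
  then obtain U where U: "finite U" "maximal U ?P"
    using maximal_exists_superset[of "set (cols M)" ?P "{}"] by auto
  then have Ucols: "U \<subseteq> set (cols M)" "lin_indpt U" by (auto simp: maximal_def)
  then have Ucarr: "U \<subseteq> carrier_vec n" using colsM by auto
  have "rank M = card U" by (rule rank_card_indpt[OF M U(2)])
  moreover obtain ws where ws: "set ws = U" "distinct ws" using finite_distinct_list[OF U(1)] by auto
  ultimately have len: "length ws \<le> k" using rank distinct_card[OF ws(2)] by simp
  have span: "c \<in> span U" if c: "c \<in> set (cols M)" for c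
  proof (rule ccontr)
    assume *: "c \<notin> span U"
    have "c \<in> carrier_vec n" using c colsM by auto
    then have "c \<notin> U" using * Ucarr span_mem by auto
    \<comment> \<open>A column outside the span could be added without losing independence, against
      maximality.\<close>
    with * have "lin_indpt (U \<union> {c})"
      using lin_dep_iff_in_span[of U c] Ucarr Ucols \<open>c \<in> carrier_vec n\<close> by auto
    then have "U \<union> {c} = U" using U(2) c Ucols(1) unfolding maximal_def by blast
    with \<open>c \<notin> U\<close> show False by auto
  qed
  have "\<exists>f. col M j = mat_of_cols n ws *\<^sub>v vec (length ws) f" if "j < m" for j
  proof -
    have "col M j \<in> set (cols M)" using that M by (auto simp: cols_def)
    then have "col M j \<in> span_list ws"
      using span span_list_as_span[of ws] ws(1) Ucarr by auto
    then obtain f where "col M j = lincomb_list f ws" by (auto simp: span_list_def)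
    also have "\<dots> = mat_of_cols n ws *\<^sub>v vec (length ws) f"
      by (rule lincomb_list_as_mat_mult) (use ws(1) Ucarr in auto)
    finally show ?thesis by blast
  qed
  then obtain f where f: "\<And>j. j < m \<Longrightarrow> col M j = mat_of_cols n ws *\<^sub>v vec (length ws) (f j)"
    by metis
  \<comment> \<open>Padding the left factor with zeros makes the inner dimension exactly
    \<open>k\<close> when the rank is smaller.\<close>
  have "M $$ (i, j) = (\<Sum>l<k. (if l < length ws then ws ! l $ i else 0) * f j l)"
    if ij: "i < n" "j < m" for i j
  proof -
    have "M $$ (i, j) = col M j $ i" using ij M by simp
    also have "\<dots> = (\<Sum>l<length ws. ws ! l $ i * f j l)"
      unfolding f[OF ij(2)] using ij(1)
      by (auto simp: scalar_prod_def mat_of_cols_index lessThan_atLeast0 intro!: sum.cong)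
    also have "\<dots> = (\<Sum>l<k. (if l < length ws then ws ! l $ i else 0) * f j l)"
      using len by (intro sum.mono_neutral_cong_left) auto
    finally show ?thesis .
  qed
  then show ?thesis by (rule that)
qed

subsection \<open>Passing to circulant factors\<close>

text \<open>The second argument counts the diagonal factors. Words begin and end with a circulant
  factor, which gives \<open>2 * r + 1\<close> factors in total.\<close>

fun circ_diag_word :: "nat \<Rightarrow> nat \<Rightarrow> complex mat set" where
  "circ_diag_word n 0 = {C. circulant_mat n C}"
| "circ_diag_word n (Suc r) = {C * D * X | C D X.
     circulant_mat n C \<and> D \<in> carrier_mat n n \<and> diagonal_mat D \<and> X \<in> circ_diag_word n r}"

lemma circ_diag_word_carrier: "X \<in> circ_diag_word n r \<Longrightarrow> X \<in> carrier_mat n n"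
  by (induction r arbitrary: X)
    (auto simp: circulant_mat_def intro!: mult_carrier_mat[of _ n n _ n])

lemma circ_diag_word_factors:
  assumes "X \<in> circ_diag_word n r"
  obtains A where "\<forall>i \<in> {1..2 * r + 1}. A i \<in> carrier_mat n n \<and>
       (odd i \<longrightarrow> circulant_mat n (A i)) \<and> (even i \<longrightarrow> diagonal_mat (A i))"
    and "mat_prod_list n (map A [1..<2 * r + 2]) = X"
  using assms
proof (induction r arbitrary: X thesis)
  case 0
  then have X: "circulant_mat n X" by simp
  then have "X \<in> carrier_mat n n" by (simp add: circulant_mat_def)
  with X show ?case by (intro 0(1)[of "\<lambda>_. X"]) (auto simp: mat_prod_list_def)
next
  case (Suc r)
  then obtain C D Y where C: "circulant_mat n C" and D: "D \<in> carrier_mat n n" "diagonal_mat D"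
    and Y: "Y \<in> circ_diag_word n r" and X: "X = C * D * Y" by auto
  from Suc.IH[OF _ Y] obtain A where A: "\<forall>i \<in> {1..2 * r + 1}. A i \<in> carrier_mat n n \<and>
       (odd i \<longrightarrow> circulant_mat n (A i)) \<and> (even i \<longrightarrow> diagonal_mat (A i))"
    "mat_prod_list n (map A [1..<2 * r + 2]) = Y" by blast
  \<comment> \<open>Two factors are prepended, so the old ones move up by two positions and keep
    their parity.\<close>
  let ?A = "\<lambda>i. if i = 1 then C else if i = 2 then D else A (i - 2)"
  have Cc: "C \<in> carrier_mat n n" using C by (simp add: circulant_mat_def)
  have props: "?A i \<in> carrier_mat n n \<and> (odd i \<longrightarrow> circulant_mat n (?A i)) \<and>
      (even i \<longrightarrow> diagonal_mat (?A i))" if i: "i \<in> {1..2 * Suc r + 1}" for i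
  proof -
    consider "i = 1" | "i = 2" | "i > 2" using i by force
    then show ?thesis
    proof cases
      case 3
      with i have "i - 2 \<in> {1..2 * r + 1}" by auto
      from A(1)[rule_format, OF this] 3 show ?thesis by auto
    qed (use C Cc D in auto)
  qed
  have "[1..<2 * Suc r + 2] = 1 # 2 # [3..<2 * r + 2 + 2]"
    by (simp add: upt_conv_Cons numeral_3_eq_3 del: upt_Suc)
  also have "[3..<2 * r + 2 + 2] = map (\<lambda>i. i + 2) [1..<2 * r + 2]"
    by (rule nth_equalityI) (auto simp del: upt_Suc)
  finally have "map ?A [1..<2 * Suc r + 2] = C # D # map A [1..<2 * r + 2]"
    by (simp del: upt_Suc)
  then have "mat_prod_list n (map ?A [1..<2 * Suc r + 2]) = C * (D * Y)"
    using A(2) by (simp add: mat_prod_list_def del: upt_Suc mult_Suc_right)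
  also have "\<dots> = X" unfolding X using Cc D circ_diag_word_carrier[OF Y]
    by (simp add: assoc_mult_mat[of _ n n _ n _ n])
  finally show ?case using props by (intro Suc.prems(1)[of ?A]) auto
qed

section \<open>The discrete Fourier transform and conjugation by it\<close>

definition root_unity :: "nat \<Rightarrow> complex" where
  "root_unity n = cis (2 * pi / n)"

text \<open>Unnormalized Fourier matrix: its row and column \<open>0\<close> consist of ones, and
  the inverse \<open>idft\<close> carries the whole factor \<open>1 / n\<close>.\<close>

definition dft :: "nat \<Rightarrow> complex mat" where
  "dft n = mat n n (\<lambda>(i, j). root_unity n ^ (i * j))"

definition idft :: "nat \<Rightarrow> complex mat" where
  "idft n = mat n n (\<lambda>(i, j). inverse (root_unity n) ^ (i * j) / n)"

lemma dft_carrier [simp]: "dft n \<in> carrier_mat n n" "idft n \<in> carrier_mat n n"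
  by (auto simp: dft_def idft_def)

lemma root_unity_nonzero [simp]: "root_unity n \<noteq> 0"
  by (simp add: root_unity_def)

lemma root_unity_pow_n: "n > 0 \<Longrightarrow> root_unity n ^ n = 1"
  by (simp add: root_unity_def DeMoivre)

lemma root_unity_pow_inj:
  assumes "i < n" and "j < n" and "root_unity n ^ i = root_unity n ^ j"
  shows "i = j"
proof -
  have "root_unity n ^ k = cis (2 * pi * real k / real n)" for k
    by (simp add: root_unity_def DeMoivre mult_ac)
  with bij_betw_imp_inj_on[OF bij_betw_roots_unity[of n]] assms show ?thesis
    by (auto simp: inj_on_def)
qed

text \<open>Orthogonality of characters: an entry is the mean of the powers of the
  \<open>n\<close>-th root of unity \<open>z\<close>, a geometric sum that vanishes unless
  \<open>z = 1\<close>.\<close>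

lemma idft_mult_dft:
  assumes "n > 0"
  shows "idft n * dft n = 1\<^sub>m n"
proof (rule eq_matI)
  fix i j assume "i < dim_row (1\<^sub>m n)" "j < dim_col (1\<^sub>m n)"
  then have ij: "i < n" "j < n" by auto
  define z where "z = root_unity n ^ j / root_unity n ^ i"
  have "(idft n * dft n) $$ (i, j) = (\<Sum>l<n. idft n $$ (i, l) * dft n $$ (l, j))"
    by (rule index_mult_mat_sum) (use ij in auto)
  also have "\<dots> = (\<Sum>l<n. z ^ l / n)"
    using ij by (intro sum.cong)
      (auto simp: idft_def dft_def z_def power_divide field_simps simp flip: power_mult)
  also have "\<dots> = (\<Sum>l<n. z ^ l) / n" by (simp add: sum_divide_distrib)
  also have "\<dots> = (if i = j then 1 else 0)"
  proof (cases "i = j")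
    case False
    have "z \<noteq> 1" using root_unity_pow_inj[OF ij(2,1)] False by (auto simp: z_def)
    moreover have "z ^ n = (root_unity n ^ n) ^ j / (root_unity n ^ n) ^ i"
      by (simp add: z_def power_divide mult.commute flip: power_mult)
    then have "z ^ n = 1" using root_unity_pow_n[OF assms] by simp
    ultimately show ?thesis using False by (simp add: geometric_sum)
  qed (use assms in \<open>simp add: z_def\<close>)
  finally show "(idft n * dft n) $$ (i, j) = 1\<^sub>m n $$ (i, j)" using ij by simp
qed (auto simp: dft_def idft_def)

lemma dft_mult_idft: "n > 0 \<Longrightarrow> dft n * idft n = 1\<^sub>m n"
  by (rule mat_mult_left_right_inverse[OF _ _ idft_mult_dft]) auto

text \<open>Entry \<open>(j, l)\<close> is the sum over \<open>p\<close> of \<open>d p / n\<close>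
  times the root of unity to the power \<open>-(j - l) p\<close>. It depends only on
  \<open>j - l\<close> modulo \<open>n\<close>, since the \<open>n\<close>-th power of the root is
  1.\<close>

lemma circulant_dft_conj_diag:
  assumes "n > 0"
  shows "circulant_mat n (idft n * mat_diag n d * dft n)"
  unfolding circulant_mat_def
proof (intro conjI bexI allI impI)
  let ?w = "root_unity n"
  let ?c = "vec n (\<lambda>m. \<Sum>p<n. d p * inverse ?w ^ (m * p) / n)"
  fix j l assume jl: "j < n" "l < n"
  define m where "m = nat ((int j - int l) mod int n)"
  have m: "m < n" using assms by (simp add: m_def nat_less_iff)
  \<comment> \<open>Over the naturals, reducing \<open>j - l\<close> modulo \<open>n\<close> either
    changes nothing or adds \<open>n\<close> once.\<close>
  have "m + l = j \<or> m + l = j + n"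
  proof (cases "l \<le> j")
    case True
    then have "(int j - int l) mod int n = int j - int l" using jl by (intro mod_pos_pos_trivial) auto
    with True show ?thesis unfolding m_def by linarith
  next
    case False
    have "(int j - int l) mod int n = (int j - int l + int n) mod int n" by simp
    also have "\<dots> = int j - int l + int n" using jl False by (intro mod_pos_pos_trivial) auto
    finally show ?thesis unfolding m_def using jl by linarith
  qed
  then have "?w ^ m * ?w ^ l = ?w ^ j"
    using root_unity_pow_n[OF assms] by (metis mult.right_neutral power_add)
  then have w: "inverse ?w ^ m = inverse ?w ^ j * ?w ^ l"
    by (auto simp: field_simps)
  have wp: "inverse ?w ^ (m * p) = inverse ?w ^ (j * p) * ?w ^ (p * l)" for p
    unfolding power_mult[of _ m p] w power_mult_distrib
    by (simp add: mult.commute flip: power_mult)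
  have "(idft n * mat_diag n d * dft n) $$ (j, l)
      = (\<Sum>p<n. (idft n * mat_diag n d) $$ (j, p) * dft n $$ (p, l))"
    by (rule index_mult_mat_sum[OF mult_carrier_mat[of _ n n _ n]]) (use jl in auto)
  also have "\<dots> = (\<Sum>p<n. d p * (inverse ?w ^ (j * p) * ?w ^ (p * l)) / n)"
    using jl by (intro sum.cong) (auto simp: mat_diag_mult_right[of _ n n] idft_def dft_def)
  also have "\<dots> = (\<Sum>p<n. d p * inverse ?w ^ (m * p) / n)" by (simp only: wp)
  also have "\<dots> = ?c $ nat ((int j - int l) mod int n)" using m by (simp flip: m_def)
  finally show "(idft n * mat_diag n d * dft n) $$ (j, l) = ?c $ nat ((int j - int l) mod int n)" .
qed (auto intro!: mult_carrier_mat[of _ n n _ n])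

text \<open>The all-ones vector is column \<open>0\<close> of \<open>dft n\<close>, and its
  transpose is \<open>n\<close> times row \<open>0\<close> of \<open>idft n\<close>. Hence
  conjugation sends the all-ones matrix to the matrix with single nonzero entry \<open>n\<close> at
  \<open>(0, 0)\<close>, and it fixes multiples of the identity.\<close>

lemma diagonal_dft_conj_scalar_plus_ones:
  assumes "n > 0"
  shows "diagonal_mat (idft n * scalar_plus_ones n c * dft n)"
  unfolding diagonal_mat_def
proof (intro allI impI)
  fix i j assume "i < dim_row (idft n * scalar_plus_ones n c * dft n)"
    "j < dim_col (idft n * scalar_plus_ones n c * dft n)" and neq: "i \<noteq> j"
  then have ij: "i < n" "j < n" by (auto simp: idft_def dft_def)
  let ?G = "\<lambda>i l. idft n $$ (i, l)" and ?F = "\<lambda>l j. dft n $$ (l, j)"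
  have delta: "(\<Sum>l<n. ?G i l * ?F l j) = (if i = j then 1 else 0)" if "i < n" "j < n" for i j
    using index_mult_mat_sum[of "idft n" n "dft n" i j] idft_mult_dft[OF assms] that by auto
  have "(\<Sum>p<n. ?G i p) = (\<Sum>p<n. ?G i p * ?F p 0)"
    using assms by (intro sum.cong) (auto simp: dft_def)
  also have "\<dots> = (if i = 0 then 1 else 0)" using ij assms by (intro delta)
  finally have sG: "(\<Sum>p<n. ?G i p) = (if i = 0 then 1 else 0)" .
  have "(\<Sum>q<n. ?F q j) = n * (\<Sum>q<n. ?G 0 q * ?F q j)"
    using assms by (simp add: idft_def flip: sum_divide_distrib)
  also have "\<dots> = (if j = 0 then n else 0)" using ij assms by (subst delta) auto
  finally have sF: "(\<Sum>q<n. ?F q j) = (if j = 0 then n else 0)" .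
  have GK: "(idft n * scalar_plus_ones n c) $$ (i, q) = c * ?G i q + (\<Sum>p<n. ?G i p)"
    if "q < n" for q
  proof -
    have "(idft n * scalar_plus_ones n c) $$ (i, q) = (\<Sum>p<n. ?G i p * scalar_plus_ones n c $$ (p, q))"
      by (rule index_mult_mat_sum) (use ij that in auto)
    also have "\<dots> = (\<Sum>p<n. (if p = q then c * ?G i p else 0) + ?G i p)"
      using that by (intro sum.cong) (auto simp: scalar_plus_ones_def algebra_simps)
    also have "\<dots> = c * ?G i q + (\<Sum>p<n. ?G i p)" using that by (simp add: sum.distrib)
    finally show ?thesis .
  qed
  have "(idft n * scalar_plus_ones n c * dft n) $$ (i, j)
      = (\<Sum>q<n. (idft n * scalar_plus_ones n c) $$ (i, q) * ?F q j)"
    by (rule index_mult_mat_sum[OF mult_carrier_mat[of _ n n _ n]]) (use ij in auto)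
  also have "\<dots> = (\<Sum>q<n. c * (?G i q * ?F q j) + (\<Sum>p<n. ?G i p) * ?F q j)"
    by (intro sum.cong) (auto simp: GK algebra_simps)
  also have "\<dots> = c * (\<Sum>q<n. ?G i q * ?F q j) + (\<Sum>p<n. ?G i p) * (\<Sum>q<n. ?F q j)"
    by (simp only: sum.distrib sum_distrib_left)
  also have "\<dots> = 0" using neq ij by (simp only: delta sG sF) auto
  finally show "(idft n * scalar_plus_ones n c * dft n) $$ (i, j) = 0" .
qed

text \<open>Inserting \<open>dft n * idft n\<close> between neighbouring factors conjugates each one
  separately: diagonal factors become circulant, shifted all-ones factors diagonal.\<close>

lemma dft_conj_word:
  assumes "n > 0" and "X \<in> diag_ones_word n r"
  shows "idft n * X * dft n \<in> circ_diag_word n r"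
  using assms(2)
proof (induction r arbitrary: X)
  case 0
  then show ?case using circulant_dft_conj_diag[OF assms(1)] by auto
next
  case (Suc r)
  then obtain d c Y where Y: "Y \<in> diag_ones_word n r"
    and X: "X = mat_diag n d * scalar_plus_ones n c * Y" by auto
  let ?K = "scalar_plus_ones n c" and ?D = "mat_diag n d" and ?F = "dft n" and ?G = "idft n"
  note [simp] = assoc_mult_mat[of _ n n _ n _ n] mult_carrier_mat[of _ n n _ n] diag_ones_word_carrier[OF Y]
  have cancel: "?F * (?G * Z) = Z" if "Z \<in> carrier_mat n n" for Z
    using that dft_mult_idft[OF assms(1)] assoc_mult_mat[of ?F n n ?G n Z n] by simp
  have "?G * X * ?F = (?G * ?D * ?F) * (?G * ?K * ?F) * (?G * Y * ?F)"
    by (simp add: X cancel)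
  moreover have "?G * ?K * ?F \<in> carrier_mat n n" by simp
  ultimately show ?case
    using circulant_dft_conj_diag[OF assms(1), of d] Suc.IH[OF Y]
      diagonal_dft_conj_scalar_plus_ones[OF assms(1), of c]
    by (simp only: circ_diag_word.simps) blast
qed

section \<open>Frobenius norm bound and assembly of the approximation\<close>

lemma frobenius_norm_less:
  assumes "A \<in> carrier_mat n n" and "n > 0"
    and "\<And>i j. i < n \<Longrightarrow> j < n \<Longrightarrow> cmod (A $$ (i, j)) < e / n"
  shows "frobenius_norm A < e"
proof -
  \<comment> \<open>Positivity of \<open>e\<close>, needed to simplify
    \<open>sqrt (e\<^sup>2)\<close>, follows from the bound on a single entry.\<close>
  have "0 \<le> cmod (A $$ (0, 0))" by simp
  also have "\<dots> < e / n" using assms(2,3) by auto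
  finally have e: "e > 0" using assms(2) by (simp add: zero_less_divide_iff)
  have "(\<Sum>i<n. \<Sum>j<n. (cmod (A $$ (i, j)))\<^sup>2) < (\<Sum>i<n. \<Sum>j<n. (e / n)\<^sup>2)"
    using assms(2,3) by (intro sum_strict_mono power_strict_mono) auto
  also have "\<dots> = e\<^sup>2" using assms(2) by (simp add: power_divide power2_eq_square)
  finally have "sqrt (\<Sum>i<n. \<Sum>j<n. (cmod (A $$ (i, j)))\<^sup>2) < sqrt (e\<^sup>2)"
    by (rule real_sqrt_less_mono)
  then show ?thesis using assms(1) e by (simp add: frobenius_norm_def)
qed

theorem theorem4p2:
  fixes n k :: nat and M :: "complex mat" and \<epsilon> :: real
  assumes "n \<ge> 1" and "k \<ge> 1" and "k dvd n"
    and "M \<in> carrier_mat n n" and "vec_space.rank n M \<le> k"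
    and "\<epsilon> > 0"
  shows "\<exists>A :: nat \<Rightarrow> complex mat.
    (\<forall>i \<in> {1..4 * k + 1}. A i \<in> carrier_mat n n \<and>
       (odd i \<longrightarrow> circulant_mat n (A i)) \<and>
       (even i \<longrightarrow> diagonal_mat (A i))) \<and>
    frobenius_norm (mat_prod_list n (map A [1..<4 * k + 2]) - M) < \<epsilon>"
proof -
  have n: "n > 0" and kn: "k \<le> n" using assms(1,3) by (auto dest: dvd_imp_le)
  note M = assms(4)
  let ?F = "dft n" and ?G = "idft n" and ?Z = "mat_diag n (\<lambda>i. if i < k then 1 else 0 :: complex)"
  obtain u v where uv: "\<And>i j. i < n \<Longrightarrow> j < n \<Longrightarrow> M $$ (i, j) = (\<Sum>l<k. u i l * v l j)"
    using rank_factorization[OF M assms(5)] by blast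
  \<comment> \<open>The factors are square; the projection \<open>?Z\<close> between them selects
    the first \<open>k\<close> columns of \<open>U\<close> and rows of \<open>V\<close>, so the
    remaining values do not affect the product.\<close>
  define U V where "U = mat n n (\<lambda>(i, l). u i l)" and "V = mat n n (\<lambda>(l, j). v l j)"
  have UV: "U \<in> carrier_mat n n" "V \<in> carrier_mat n n" by (auto simp: U_def V_def)
  have UZ: "(U * ?Z) $$ (i, l) = (if l < k then u i l else 0)" if "i < n" "l < n" for i l
    using that by (simp add: mat_diag_mult_right[OF UV(1)]) (simp add: U_def)
  have "(U * ?Z * V) $$ (i, j) = M $$ (i, j)" if ij: "i < n" "j < n" for i j
  proof -
    have "(U * ?Z * V) $$ (i, j) = (\<Sum>l<n. (U * ?Z) $$ (i, l) * V $$ (l, j))"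
      by (rule index_mult_mat_sum[OF mult_carrier_mat[of _ n n _ n]]) (use ij UV in auto)
    also have "\<dots> = (\<Sum>l<k. u i l * v l j)"
      using kn ij by (intro sum.mono_neutral_cong_right)
        (auto simp: UZ V_def)
    finally show ?thesis using uv ij by simp
  qed
  then have M_eq: "M = U * ?Z * V" using M UV by (intro eq_matI) auto
  text \<open>The columns of \<open>F * U\<close> and the rows of \<open>V * G\<close> with index at least \<open>k\<close> are annihilated
    by \<open>Z\<close>, so they may be replaced by those of the identity.\<close>
  define P where "P = mat n n (\<lambda>(i, j). if j < k then (?F * U) $$ (i, j) else if i = j then 1 else 0)"
  define Q where "Q = mat n n (\<lambda>(i, j). if i < k then (V * ?G) $$ (i, j) else if i = j then 1 else 0)"
  have PQ: "P \<in> carrier_mat n n" "Q \<in> carrier_mat n n" by (auto simp: P_def Q_def)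
  have PZ: "P * ?Z = ?F * U * ?Z" and ZQ: "?Z * Q = ?Z * (V * ?G)"
    using PQ UV
    by (auto simp: mat_diag_mult_right[of _ n n] mat_diag_mult_left[of _ n n]
        mult_carrier_mat[of _ n n _ n] P_def Q_def intro!: eq_matI)
  \<comment> \<open>Idempotence provides one copy of \<open>?Z\<close> for \<open>P\<close> and one
    for \<open>Q\<close>, so both replacements can be made in the same product.\<close>
  have ZZ: "?Z * ?Z = ?Z" unfolding mat_diag_diag by (intro arg_cong[of _ _ "mat_diag n"]) auto
  have "P \<in> mat_cl n (diag_ones_word n k)"
    by (rule unit_cols_in_closure[OF kn PQ(1)]) (simp add: P_def)
  moreover have "?Z \<in> mat_cl n (diag_ones_word n 0)" by (rule mat_cl_superset) auto
  ultimately have PZ_cl: "P * ?Z \<in> mat_cl n (diag_ones_word n (k + 0))"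
    by (rule mat_cl_mult) (rule word_mult_word)
  \<comment> \<open>\<open>Q\<close> differs from the identity in its first \<open>k\<close> rows,
    so the column result applies to its transpose.\<close>
  have "transpose_mat Q \<in> mat_cl n (diag_ones_word n k)"
    using PQ(2) by (intro unit_cols_in_closure[OF kn]) (auto simp: Q_def)
  then have "Q \<in> mat_cl n (diag_ones_word n k)"
    using mat_cl_transpose[OF _ transpose_word] by fastforce
  with PZ_cl have N_cl: "P * ?Z * Q \<in> mat_cl n (diag_ones_word n (k + 0 + k))"
    by (rule mat_cl_mult) (rule word_mult_word)
  note [simp] = assoc_mult_mat[of _ n n _ n _ n] mult_carrier_mat[of _ n n _ n]
  have "P * ?Z * Q = (P * ?Z) * (?Z * Q)" 
    using PQ ZZ assoc_mult_mat[of ?Z n n ?Z n Q n] by simp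
  also have "\<dots> = ?F * M * ?G"
    unfolding PZ ZQ M_eq using UV ZZ assoc_mult_mat[of ?Z n n ?Z n "V * ?G" n] by simp
  finally have N: "P * ?Z * Q = ?F * M * ?G" .
  \<comment> \<open>Multiplying approximants of \<open>?F * M * ?G\<close> by the fixed matrices
    \<open>?G\<close> and \<open>?F\<close> gives approximants of \<open>M\<close>. The
    \<open>k + k\<close> shifted all-ones factors become \<open>2 * k\<close> diagonal ones, hence
    \<open>4 * k + 1\<close> factors in all.\<close>
  have "?G * (P * ?Z * Q) \<in> mat_cl n {?G * X | X. X \<in> diag_ones_word n (2 * k)}"
    by (rule mat_cl_mult[OF mat_cl_superset[of ?G "{?G}"] N_cl]) (auto simp: mult_2)
  then have "?G * (P * ?Z * Q) * ?F \<in> mat_cl n (circ_diag_word n (2 * k))"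
    by (rule mat_cl_mult[OF _ mat_cl_superset[of ?F "{?F}"]]) (auto intro: dft_conj_word[OF n])
  also have "?G * (P * ?Z * Q) * ?F = (?G * ?F) * M * (?G * ?F)"
    unfolding N using M by simp
  also have "\<dots> = M" using M by (simp add: idft_mult_dft[OF n])
  finally have "M \<in> mat_cl n (circ_diag_word n (2 * k))" .
  moreover have "\<epsilon> / n > 0" using assms(6) n by simp
  ultimately obtain X where X: "X \<in> circ_diag_word n (2 * k)"
    "\<And>i j. i < n \<Longrightarrow> j < n \<Longrightarrow> cmod (X $$ (i, j) - M $$ (i, j)) < \<epsilon> / n"
    unfolding mat_cl_def by blast
  have "frobenius_norm (X - M) < \<epsilon>"
    using X M circ_diag_word_carrier[OF X(1)] by (intro frobenius_norm_less[OF _ n]) auto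
  moreover from circ_diag_word_factors[OF X(1)] obtain A where
    "\<forall>i \<in> {1..2 * (2 * k) + 1}. A i \<in> carrier_mat n n \<and>
       (odd i \<longrightarrow> circulant_mat n (A i)) \<and> (even i \<longrightarrow> diagonal_mat (A i))"
    "mat_prod_list n (map A [1..<2 * (2 * k) + 2]) = X" by blast
  ultimately show ?thesis by (intro exI[of _ A]) (simp add: mult.assoc[symmetric] del: upt_Suc)
qed

end
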